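(* Let $R$ be a Bézout domain and let $A,B,C\in R^{n\times n}$ satisfy $ABA=ACA$. If $R_r(A)=R_r(ABA)$, then $AB$ is similar to $CA$.
   Context: A Bézout domain is an integral domain in which every finitely generated ideal is principal. For $M\in R^{m\times n}$, $R_r(M)=\{Mx : x\in R^{n\times 1}\}\subseteq R^{m\times 1}$ is the column space of $M$. Two matrices $M,N\in R^{n\times n}$ are similar if $M=S^{-1}NS$ for some invertible $S\in R^{n\times n}$. *)

theory Defs
  imports "Jordan_Normal_Form.Matrix"
begin

text \<open>A Bezout domain: an integral domain (type class idom) in which every finitely
generated ideal is principal. The ideal generated by a finite set S is the set of
all R-linear combinations of elements of S.\<close>
definition bezout_domain :: "'a::idom itself \<Rightarrow> bool" where
  "bezout_domain _ \<longleftrightarrow>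
     (\<forall>S::'a set. finite S \<longrightarrow>
        (\<exists>d::'a. {(\<Sum>s\<in>S. r s * s) | r. True} = {d * z | z. True}))"

text \<open>Column space R_r(M) = { M x : x in R^(n x 1) } for an m x n matrix M.\<close>
definition col_space :: "'a::semiring_0 mat \<Rightarrow> 'a vec set" where
  "col_space M = {M *\<^sub>v x | x. x \<in> carrier_vec (dim_col M)}"

end

theory Submission
  imports Defs "Jordan_Normal_Form.Determinant"
begin

text \<open>
  Put \<open>M = A B\<close> and \<open>N = C A\<close>. Then \<open>M A = A N\<close>, and the column space hypothesis
  gives \<open>A = M A X = A N X\<close> for some \<open>X\<close>; hence \<open>N = N N X\<close>, and both \<open>M\<close> and \<open>N\<close>
  have index at most one: their column spaces are those of their squares. Over a Bezout
  domain every column space is free (row reduction with Bezout combinations), and an onto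
  endomorphism of a free module of finite rank is injective, so \<open>R\<^sup>n = col M \<oplus> ker M\<close>
  and \<open>R\<^sup>n = col N \<oplus> ker N\<close> with free summands. Multiplication by \<open>A\<close> is an isomorphism
  \<open>col N \<rightarrow> col M\<close> intertwining \<open>N\<close> and \<open>M\<close>. Completing a basis \<open>P\<close> of \<open>col N\<close> and
  the basis \<open>A P\<close> of \<open>col M\<close> by bases of the kernels yields invertible matrices
  \<open>S = [P | K]\<close> and \<open>R = [A P | L]\<close>, and \<open>W = R S\<^sup>-\<^sup>1\<close> satisfies \<open>M W = A N = W N\<close>.
\<close>

section \<open>Column spaces\<close>

lemma mult_mat_vec_zero:
  fixes G :: "'a::semiring_0 mat"
  assumes "G \<in> carrier_mat n m"
  shows "G *\<^sub>v 0\<^sub>v m = 0\<^sub>v n"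
  using assms by (intro eq_vecI) (auto simp: scalar_prod_def)

lemma mult_mat_vec_uminus:
  fixes G :: "'a::comm_ring_1 mat"
  assumes "G \<in> carrier_mat n m" and "x \<in> carrier_vec m"
  shows "G *\<^sub>v (- x) = - (G *\<^sub>v x)"
  using assms by (intro eq_vecI) (auto simp: scalar_prod_def sum_negf)

lemma mult_mat_vec_unit_vec:
  fixes G :: "'a::comm_ring_1 mat"
  assumes "G \<in> carrier_mat n m" and "j < m"
  shows "G *\<^sub>v unit_vec m j = col G j"
  using assms by (intro eq_vecI) (auto simp: scalar_prod_right_unit)

lemma mult_mat_vec_zero_row:
  fixes G :: "'a::semiring_0 mat"
  assumes "G \<in> carrier_mat n m" and "t < n" and "\<And>j. j < m \<Longrightarrow> G $$ (t, j) = 0"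
    and "x \<in> carrier_vec m"
  shows "(G *\<^sub>v x) $ t = 0"
  using assms by (simp add: scalar_prod_def)

lemma mat_eq_on_vecI:
  fixes G H :: "'a::comm_ring_1 mat"
  assumes "G \<in> carrier_mat n m" and "H \<in> carrier_mat n m"
    and "\<And>x. x \<in> carrier_vec m \<Longrightarrow> G *\<^sub>v x = H *\<^sub>v x"
  shows "G = H"
  using assms by (intro mat_col_eqI) (auto simp flip: mult_mat_vec_unit_vec)

lemma mult_mat_vec_mem_col_space [intro]:
  "G \<in> carrier_mat n m \<Longrightarrow> x \<in> carrier_vec m \<Longrightarrow> G *\<^sub>v x \<in> col_space G"
  unfolding col_space_def by auto

lemma mem_col_spaceE:
  assumes "v \<in> col_space G" and "G \<in> carrier_mat n m"
  obtains x where "x \<in> carrier_vec m" and "v = G *\<^sub>v x"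
  using assms unfolding col_space_def by auto

lemma col_space_carrier: "G \<in> carrier_mat n m \<Longrightarrow> col_space G \<subseteq> carrier_vec n"
  unfolding col_space_def by auto

lemma zero_mem_col_space:
  fixes G :: "'a::semiring_0 mat"
  shows "G \<in> carrier_mat n m \<Longrightarrow> 0\<^sub>v n \<in> col_space G"
  by (metis mult_mat_vec_mem_col_space mult_mat_vec_zero zero_carrier_vec)

lemma add_mem_col_space:
  fixes G :: "'a::comm_ring_1 mat"
  assumes G: "G \<in> carrier_mat n m" and "u \<in> col_space G" and "w \<in> col_space G"
  shows "u + w \<in> col_space G"
proof -
  obtain x y where "x \<in> carrier_vec m" "y \<in> carrier_vec m" "u = G *\<^sub>v x" "w = G *\<^sub>v y"
    using assms by (metis mem_col_spaceE)
  then show ?thesis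
    using G by (metis add_carrier_vec mult_add_distrib_mat_vec mult_mat_vec_mem_col_space)
qed

lemma uminus_mem_col_space:
  fixes G :: "'a::comm_ring_1 mat"
  assumes G: "G \<in> carrier_mat n m" and "u \<in> col_space G"
  shows "- u \<in> col_space G"
  using assms
  by (metis mem_col_spaceE mult_mat_vec_mem_col_space mult_mat_vec_uminus uminus_carrier_vec)

lemma col_space_one_mat: "col_space (1\<^sub>m n :: 'a::semiring_1 mat) = carrier_vec n"
  unfolding col_space_def by force

lemma col_space_zero_mat: "col_space (0\<^sub>m n m :: 'a::semiring_0 mat) = {0\<^sub>v n}"
  unfolding col_space_def by (auto intro!: eq_vecI exI[of _ "0\<^sub>v m"])

lemma col_space_mult:
  fixes G H :: "'a::comm_ring_1 mat"
  assumes "G \<in> carrier_mat n k" and "H \<in> carrier_mat k m"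
  shows "col_space (G * H) = (\<lambda>v. G *\<^sub>v v) ` col_space H"
proof (intro equalityI subsetI)
  fix v assume "v \<in> col_space (G * H)"
  then obtain x where "x \<in> carrier_vec m" and "v = G *\<^sub>v (H *\<^sub>v x)"
    using assms by (auto elim!: mem_col_spaceE)
  then show "v \<in> (\<lambda>v. G *\<^sub>v v) ` col_space H"
    using assms by blast
next
  fix v assume "v \<in> (\<lambda>v. G *\<^sub>v v) ` col_space H"
  then obtain x where "x \<in> carrier_vec m" and "v = (G * H) *\<^sub>v x"
    using assms by (auto elim!: mem_col_spaceE)
  then show "v \<in> col_space (G * H)"
    using assms by (metis mult_carrier_mat mult_mat_vec_mem_col_space)
qed

lemma col_space_mult_subset:
  fixes G H :: "'a::comm_ring_1 mat"
  assumes "G \<in> carrier_mat n k" and "H \<in> carrier_mat k m"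
  shows "col_space (G * H) \<subseteq> col_space G"
  using assms col_space_carrier[OF assms(2)] by (auto simp: col_space_mult)

lemma col_space_subset_imp_factor:
  fixes G H :: "'a::comm_ring_1 mat"
  assumes G: "G \<in> carrier_mat n k" and H: "H \<in> carrier_mat n m"
    and sub: "col_space H \<subseteq> col_space G"
  obtains X where "X \<in> carrier_mat k m" and "H = G * X"
proof -
  have "col H j \<in> col_space G" if "j < m" for j
    using sub mult_mat_vec_unit_vec[OF H that]
      mult_mat_vec_mem_col_space[OF H unit_vec_carrier[of m j]]
    by (metis subsetD)
  then have "\<forall>j\<in>{..<m}. \<exists>x. x \<in> carrier_vec k \<and> col H j = G *\<^sub>v x"
    using G by (auto elim!: mem_col_spaceE)
  then obtain xs where xs: "\<And>j. j < m \<Longrightarrow> xs j \<in> carrier_vec k \<and> col H j = G *\<^sub>v xs j"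
    by (metis bchoice lessThan_iff)
  let ?X = "mat_of_cols k (map xs [0..<m])"
  have "H = G * ?X"
    using G H xs by (intro mat_col_eqI) auto
  moreover have "?X \<in> carrier_mat k m"
    using mat_of_cols_carrier(1)[of k "map xs [0..<m]"] by simp
  ultimately show ?thesis
    using that by blast
qed

lemma col_space_mult_eq_of_factor:
  fixes A N X :: "'a::comm_ring_1 mat"
  assumes A: "A \<in> carrier_mat n k" and N: "N \<in> carrier_mat k l" and X: "X \<in> carrier_mat l m"
    and ANX: "A * N * X = A"
  shows "col_space (A * N) = col_space A"
  using col_space_mult_subset[OF A N] col_space_mult_subset[OF mult_carrier_mat[OF A N] X] ANX
  by auto

lemma col_space_add_diff_mult:
  fixes G V Q :: "'a::comm_ring_1 mat"
  assumes G: "G \<in> carrier_mat n m" and V: "V \<in> carrier_mat n a" and Q: "Q \<in> carrier_mat a m"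
    and sub: "col_space V \<subseteq> col_space G"
  shows "col_space G = {u + w |u w. u \<in> col_space V \<and> w \<in> col_space (G - V * Q)}"
proof (intro equalityI subsetI)
  fix v assume "v \<in> col_space G"
  then obtain y where y: "y \<in> carrier_vec m" and v: "v = G *\<^sub>v y"
    using G by (auto elim: mem_col_spaceE)
  have "(G - V * Q) *\<^sub>v y = G *\<^sub>v y - V *\<^sub>v (Q *\<^sub>v y)"
    using G V Q y by (simp add: minus_mult_distrib_mat_vec[of G n m "V * Q"])
  then have "v = V *\<^sub>v (Q *\<^sub>v y) + (G - V * Q) *\<^sub>v y"
    using G V Q y by (auto simp: v intro!: eq_vecI)
  moreover have "V *\<^sub>v (Q *\<^sub>v y) \<in> col_space V" and "(G - V * Q) *\<^sub>v y \<in> col_space (G - V * Q)"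
    using G V Q y by auto
  ultimately show "v \<in> {u + w |u w. u \<in> col_space V \<and> w \<in> col_space (G - V * Q)}"
    by blast
next
  fix v assume "v \<in> {u + w |u w. u \<in> col_space V \<and> w \<in> col_space (G - V * Q)}"
  then obtain x y where x: "x \<in> carrier_vec a" and y: "y \<in> carrier_vec m"
    and v: "v = V *\<^sub>v x + (G - V * Q) *\<^sub>v y"
    using G V Q by (auto elim!: mem_col_spaceE)
  have "v = G *\<^sub>v y + (- (V *\<^sub>v (Q *\<^sub>v y)) + V *\<^sub>v x)"
    using G V Q x y by (auto simp: v minus_mult_distrib_mat_vec[of G n m "V * Q"] intro!: eq_vecI)
  moreover have "V *\<^sub>v (Q *\<^sub>v y) \<in> col_space G" and "V *\<^sub>v x \<in> col_space G"
    using V Q x y sub mult_mat_vec_mem_col_space[OF V] by (meson mult_mat_vec_carrier subsetD)+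
  ultimately show "v \<in> col_space G"
    using G y by (metis add_mem_col_space uminus_mem_col_space mult_mat_vec_mem_col_space)
qed

lemma inj_on_mult_mat_vecI:
  fixes P :: "'a::comm_ring_1 mat"
  assumes P: "P \<in> carrier_mat n m"
    and zero: "\<And>x. x \<in> carrier_vec m \<Longrightarrow> P *\<^sub>v x = 0\<^sub>v n \<Longrightarrow> x = 0\<^sub>v m"
  shows "inj_on ((*\<^sub>v) P) (carrier_vec m)"
proof (rule inj_onI)
  fix x y assume x: "x \<in> carrier_vec m" and y: "y \<in> carrier_vec m" and "P *\<^sub>v x = P *\<^sub>v y"
  then have "P *\<^sub>v (x - y) = 0\<^sub>v n"
    using P by (simp add: mult_minus_distrib_mat_vec)
  then have xy: "x - y = 0\<^sub>v m"
    using zero x y by simp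
  show "x = y"
  proof (rule eq_vecI)
    fix i assume "i < dim_vec y"
    then show "x $ i = y $ i"
      using arg_cong[OF xy, of "\<lambda>v. v $ i"] x y by simp
  qed (use x y in simp)
qed

lemma inj_on_mult_mat_vecD:
  fixes P :: "'a::semiring_0 mat"
  assumes "inj_on ((*\<^sub>v) P) (carrier_vec m)" and "P \<in> carrier_mat n m"
    and "x \<in> carrier_vec m" and "P *\<^sub>v x = 0\<^sub>v n"
  shows "x = 0\<^sub>v m"
  using assms mult_mat_vec_zero[OF assms(2)] by (metis inj_onD zero_carrier_vec)

lemma inj_on_mult_mat_cancel_left:
  fixes P :: "'a::comm_ring_1 mat"
  assumes inj: "inj_on ((*\<^sub>v) P) (carrier_vec m)" and P: "P \<in> carrier_mat n m"
    and X: "X \<in> carrier_mat m k" and Z: "Z \<in> carrier_mat m k" and eq: "P * X = P * Z"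
  shows "X = Z"
proof (rule mat_col_eqI)
  fix j assume "j < dim_col Z"
  then have j: "j < k"
    using Z by simp
  have "P *\<^sub>v col X j = P *\<^sub>v col Z j"
    using eq col_mult2[OF P X j] col_mult2[OF P Z j] by metis
  then show "col X j = col Z j"
    using inj X Z j by (auto elim!: inj_onD)
qed (use X Z in auto)

section \<open>Appending columns\<close>

definition append_cols :: "'a::zero mat \<Rightarrow> 'a mat \<Rightarrow> 'a mat" where
  "append_cols P K = four_block_mat P K (0\<^sub>m 0 (dim_col P)) (0\<^sub>m 0 (dim_col K))"

lemma append_cols_carrier [simp]:
  "P \<in> carrier_mat n a \<Longrightarrow> K \<in> carrier_mat n b \<Longrightarrow> append_cols P K \<in> carrier_mat n (a + b)"
  unfolding append_cols_def by auto

lemma append_cols_mult_vec: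
  fixes P K :: "'a::comm_ring_1 mat"
  assumes P: "P \<in> carrier_mat n a" and K: "K \<in> carrier_mat n b"
    and x: "x \<in> carrier_vec a" and y: "y \<in> carrier_vec b"
  shows "append_cols P K *\<^sub>v (x @\<^sub>v y) = P *\<^sub>v x + K *\<^sub>v y"
proof -
  have "append_cols P K *\<^sub>v (x @\<^sub>v y)
      = (P *\<^sub>v x + K *\<^sub>v y) @\<^sub>v (0\<^sub>m 0 a *\<^sub>v x + 0\<^sub>m 0 b *\<^sub>v y)"
    unfolding append_cols_def using P K by (auto intro!: four_block_mat_mult_vec x y)
  also have "\<dots> = P *\<^sub>v x + K *\<^sub>v y"
    using P K by (intro eq_vecI) auto
  finally show ?thesis .
qed

lemma append_vec_split:
  assumes "z \<in> carrier_vec (a + b)"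
  obtains x y where "x \<in> carrier_vec a" and "y \<in> carrier_vec b" and "z = x @\<^sub>v y"
  using assms by (metis vec_first_carrier vec_last_carrier vec_first_last_append)

lemma mult_append_cols:
  fixes G P K :: "'a::comm_ring_1 mat"
  assumes G: "G \<in> carrier_mat k n" and P: "P \<in> carrier_mat n a" and K: "K \<in> carrier_mat n b"
  shows "G * append_cols P K = append_cols (G * P) (G * K)"
proof (rule mat_eq_on_vecI[of _ k "a + b"])
  fix z :: "'a vec" assume hz: "z \<in> carrier_vec (a + b)"
  then obtain x y where x: "x \<in> carrier_vec a" and y: "y \<in> carrier_vec b" and z: "z = x @\<^sub>v y"
    by (rule append_vec_split)
  have "(G * append_cols P K) *\<^sub>v z = G *\<^sub>v (append_cols P K *\<^sub>v z)"
    by (rule assoc_mult_mat_vec[OF G append_cols_carrier[OF P K] hz])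
  also have "\<dots> = append_cols (G * P) (G * K) *\<^sub>v z"
    using G P K x y append_cols_mult_vec[of "G * P" k a "G * K" b x y]
    by (simp add: z append_cols_mult_vec mult_add_distrib_mat_vec[of G k n])
  finally show "(G * append_cols P K) *\<^sub>v z = append_cols (G * P) (G * K) *\<^sub>v z" .
qed (use G P K in auto)

lemma col_space_append_cols:
  fixes P K :: "'a::comm_ring_1 mat"
  assumes P: "P \<in> carrier_mat n a" and K: "K \<in> carrier_mat n b"
  shows "col_space (append_cols P K) = {u + w |u w. u \<in> col_space P \<and> w \<in> col_space K}"
proof (intro equalityI subsetI)
  fix v assume "v \<in> col_space (append_cols P K)"
  then obtain z where hz: "z \<in> carrier_vec (a + b)" and v: "v = append_cols P K *\<^sub>v z"
    by (rule mem_col_spaceE[OF _ append_cols_carrier[OF P K]])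
  from hz obtain x y where "x \<in> carrier_vec a" "y \<in> carrier_vec b" "z = x @\<^sub>v y"
    by (rule append_vec_split)
  then show "v \<in> {u + w |u w. u \<in> col_space P \<and> w \<in> col_space K}"
    using P K by (auto simp: v append_cols_mult_vec)
next
  fix v assume "v \<in> {u + w |u w. u \<in> col_space P \<and> w \<in> col_space K}"
  then obtain x y where "x \<in> carrier_vec a" "y \<in> carrier_vec b" "v = P *\<^sub>v x + K *\<^sub>v y"
    using P K by (auto elim!: mem_col_spaceE)
  then show "v \<in> col_space (append_cols P K)"
    using P K by (metis append_carrier_vec append_cols_carrier append_cols_mult_vec
        mult_mat_vec_mem_col_space)
qed

lemma inj_on_append_cols:
  fixes P K :: "'a::comm_ring_1 mat"
  assumes P: "P \<in> carrier_mat n a" and K: "K \<in> carrier_mat n b"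
    and inj_P: "inj_on ((*\<^sub>v) P) (carrier_vec a)" and inj_K: "inj_on ((*\<^sub>v) K) (carrier_vec b)"
    and disjoint: "col_space P \<inter> col_space K = {0\<^sub>v n}"
  shows "inj_on ((*\<^sub>v) (append_cols P K)) (carrier_vec (a + b))"
proof (rule inj_on_mult_mat_vecI)
  fix z assume "z \<in> carrier_vec (a + b)" and z0: "append_cols P K *\<^sub>v z = 0\<^sub>v n"
  from this(1) obtain x y
    where x: "x \<in> carrier_vec a" and y: "y \<in> carrier_vec b" and z: "z = x @\<^sub>v y"
    by (rule append_vec_split)
  have sum0: "P *\<^sub>v x + K *\<^sub>v y = 0\<^sub>v n"
    using z0 P K x y by (simp add: z append_cols_mult_vec)
  have "P *\<^sub>v x = - (K *\<^sub>v y)"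
  proof (rule eq_vecI)
    fix i assume "i < dim_vec (- (K *\<^sub>v y))"
    then show "(P *\<^sub>v x) $ i = (- (K *\<^sub>v y)) $ i"
      using arg_cong[OF sum0, of "\<lambda>v. v $ i"] P K by (simp add: eq_neg_iff_add_eq_0)
  qed (use P K in simp)
  then have "P *\<^sub>v x \<in> col_space P \<inter> col_space K"
    using P K x y by (metis IntI mult_mat_vec_mem_col_space uminus_mem_col_space)
  then have Px: "P *\<^sub>v x = 0\<^sub>v n"
    using disjoint by blast
  then have "K *\<^sub>v y = 0\<^sub>v n"
    using sum0 K y by simp
  then show "z = 0\<^sub>v (a + b)"
    using Px inj_on_mult_mat_vecD[OF inj_P P x] inj_on_mult_mat_vecD[OF inj_K K y]
    by (auto simp: z intro!: eq_vecI)
qed (use P K in simp)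

lemma inj_on_append_col:
  fixes V P :: "'a::idom mat"
  assumes V: "V \<in> carrier_mat n 1" and t: "t < n" "V $$ (t, 0) \<noteq> 0"
    and P: "P \<in> carrier_mat n k" and inj_P: "inj_on ((*\<^sub>v) P) (carrier_vec k)"
    and P_t: "\<And>u. u \<in> col_space P \<Longrightarrow> u $ t = 0"
  shows "inj_on ((*\<^sub>v) (append_cols V P)) (carrier_vec (1 + k))"
proof -
  have V_t: "x = 0\<^sub>v 1" if "x \<in> carrier_vec 1" and "(V *\<^sub>v x) $ t = 0" for x
    using that V t by (auto simp: scalar_prod_def intro!: eq_vecI)
  have "col_space V \<inter> col_space P = {0\<^sub>v n}"
  proof (intro equalityI subsetI)
    fix u assume "u \<in> col_space V \<inter> col_space P"
    then obtain x where x: "x \<in> carrier_vec 1" and u: "u = V *\<^sub>v x" and "u $ t = 0"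
      using V P_t by (auto elim: mem_col_spaceE)
    then have "x = 0\<^sub>v 1"
      using V_t by simp
    then show "u \<in> {0\<^sub>v n}"
      using u mult_mat_vec_zero[OF V] by simp
  qed (use V P zero_mem_col_space in auto)
  moreover have "inj_on ((*\<^sub>v) V) (carrier_vec 1)"
  proof (rule inj_on_mult_mat_vecI[OF V])
    fix x :: "'a vec" assume x: "x \<in> carrier_vec 1" and "V *\<^sub>v x = 0\<^sub>v n"
    then have "(V *\<^sub>v x) $ t = 0"
      using t by simp
    then show "x = 0\<^sub>v 1"
      using V_t x by blast
  qed
  ultimately show ?thesis
    using inj_on_append_cols[OF V P _ inj_P] by blast
qed

lemma append_cols_left_inverse_mult:
  fixes P K Q L S' :: "'a::comm_ring_1 mat"
  assumes P: "P \<in> carrier_mat n s" and K: "K \<in> carrier_mat n k"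
    and Q: "Q \<in> carrier_mat n s" and L: "L \<in> carrier_mat n k"
    and S': "S' \<in> carrier_mat (s + k) n" and S'S: "S' * append_cols P K = 1\<^sub>m (s + k)"
  shows "append_cols Q L * S' * P = Q"
proof (rule mat_eq_on_vecI[of _ n s])
  fix x :: "'a vec" assume x: "x \<in> carrier_vec s"
  have x0: "x @\<^sub>v 0\<^sub>v k \<in> carrier_vec (s + k)"
    using x by simp
  have "P *\<^sub>v x = append_cols P K *\<^sub>v (x @\<^sub>v 0\<^sub>v k)"
    using P K x by (simp add: append_cols_mult_vec mult_mat_vec_zero)
  also have "S' *\<^sub>v \<dots> = (S' * append_cols P K) *\<^sub>v (x @\<^sub>v 0\<^sub>v k)"
    by (rule assoc_mult_mat_vec[symmetric, OF S' append_cols_carrier[OF P K] x0])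
  finally have S'P: "S' *\<^sub>v (P *\<^sub>v x) = x @\<^sub>v 0\<^sub>v k"
    using x0 by (simp add: S'S)
  have "(append_cols Q L * S' * P) *\<^sub>v x = (append_cols Q L * S') *\<^sub>v (P *\<^sub>v x)"
    by (rule assoc_mult_mat_vec[OF mult_carrier_mat[OF append_cols_carrier[OF Q L] S'] P x])
  also have "\<dots> = append_cols Q L *\<^sub>v (S' *\<^sub>v (P *\<^sub>v x))"
    by (rule assoc_mult_mat_vec[OF append_cols_carrier[OF Q L] S' mult_mat_vec_carrier[OF P x]])
  also have "\<dots> = Q *\<^sub>v x"
    using Q L x by (simp add: S'P append_cols_mult_vec mult_mat_vec_zero)
  finally show "(append_cols Q L * S' * P) *\<^sub>v x = Q *\<^sub>v x" .
qed (use mult_carrier_mat[OF mult_carrier_mat[OF append_cols_carrier[OF Q L] S'] P] Q in auto)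

section \<open>Bijective matrices are square and invertible\<close>

lemma mat_right_inverse_dim_le:
  fixes S :: "'a::idom mat"
  assumes S: "S \<in> carrier_mat n m" and T: "T \<in> carrier_mat m n" and ST: "S * T = 1\<^sub>m n"
  shows "n \<le> m"
proof (rule ccontr)
  assume "\<not> n \<le> m"
  \<comment> \<open>\<open>S * E\<close> is \<open>S\<close> padded with zero columns; it has a right inverse but kills a unit vector\<close>
  define E :: "'a mat" where "E = mat m n (\<lambda>(i, j). if i = j then 1 else 0)"
  have E: "E \<in> carrier_mat m n" and Et: "transpose_mat E \<in> carrier_mat n m"
    unfolding E_def by auto
  have "E * transpose_mat E = 1\<^sub>m m"
    using \<open>\<not> n \<le> m\<close>
    by (intro eq_matI) (auto simp: E_def scalar_prod_def if_distrib[of "\<lambda>x. x * _"] sum.delta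
        cong: if_cong)
  then have EEt: "E *\<^sub>v (transpose_mat E *\<^sub>v w) = w" if "w \<in> carrier_vec m" for w
    using E Et that by (metis assoc_mult_mat_vec one_mult_mat_vec)
  have "(S * E) * (transpose_mat E * T) = 1\<^sub>m n"
  proof (rule mat_eq_on_vecI)
    fix v :: "'a vec" assume v: "v \<in> carrier_vec n"
    have "(S * E) * (transpose_mat E * T) *\<^sub>v v = (S * E) *\<^sub>v ((transpose_mat E * T) *\<^sub>v v)"
      by (rule assoc_mult_mat_vec) (use S T E Et v in auto)
    also have "\<dots> = S *\<^sub>v (E *\<^sub>v (transpose_mat E *\<^sub>v (T *\<^sub>v v)))"
      using S T E Et v by simp
    also have "\<dots> = S *\<^sub>v (T *\<^sub>v v)"
      using EEt T v by simp
    also have "\<dots> = v"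
      using S T v ST by (metis assoc_mult_mat_vec one_mult_mat_vec)
    finally show "(S * E) * (transpose_mat E * T) *\<^sub>v v = 1\<^sub>m n *\<^sub>v v"
      using v by simp
  qed (use S T E Et in auto)
  then have "det (S * E) \<noteq> 0"
    using det_mult[of "S * E" n "transpose_mat E * T"] S T E Et by auto
  moreover have "E *\<^sub>v unit_vec n m = 0\<^sub>v m"
    using E \<open>\<not> n \<le> m\<close> by (simp add: mult_mat_vec_unit_vec) (auto simp: E_def intro!: eq_vecI)
  then have "(S * E) *\<^sub>v unit_vec n m = 0\<^sub>v n"
    using S E by (simp add: mult_mat_vec_zero)
  then have "det (S * E) = 0"
    using S E \<open>\<not> n \<le> m\<close>
    by (subst det_0_iff_vec_prod_zero[of _ n]) (auto intro!: exI[of _ "unit_vec n m"])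
  ultimately show False
    by contradiction
qed

lemma bij_mat_inverse:
  fixes S :: "'a::idom mat"
  assumes S: "S \<in> carrier_mat n m" and surj: "col_space S = carrier_vec n"
    and inj: "inj_on ((*\<^sub>v) S) (carrier_vec m)"
  obtains T where "m = n" and "T \<in> carrier_mat n n" and "S * T = 1\<^sub>m n" and "T * S = 1\<^sub>m n"
proof -
  obtain T where T: "T \<in> carrier_mat m n" and ST: "1\<^sub>m n = S * T"
    using col_space_subset_imp_factor[OF S one_carrier_mat[of n]] surj col_space_one_mat by blast
  have "S * (T * S) = S * 1\<^sub>m m"
    using S T by (simp flip: assoc_mult_mat[OF S T S] ST)
  then have TS: "T * S = 1\<^sub>m m"
    by (rule inj_on_mult_mat_cancel_left[OF inj S, rotated 2]) (use S T in auto)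
  have "m = n"
    using mat_right_inverse_dim_le[OF S T ST[symmetric]] mat_right_inverse_dim_le[OF T S TS] by simp
  then show ?thesis
    using that T ST TS by simp
qed

section \<open>Column spaces over a Bezout domain are free\<close>

lemma sum_image_representatives:
  fixes g :: "'b \<Rightarrow> 'c" and h :: "'c \<Rightarrow> 'a::comm_monoid_add"
  assumes "finite I"
  obtains J where "J \<subseteq> I" and "(\<Sum>s\<in>g ` I. h s) = (\<Sum>i\<in>J. h (g i))"
proof -
  let ?J = "inv_into I g ` g ` I"
  have bij: "bij_betw (inv_into I g) (g ` I) ?J"
    by (simp add: bij_betw_def inj_on_inv_into)
  have "(\<Sum>s\<in>g ` I. h s) = (\<Sum>s\<in>g ` I. h (g (inv_into I g s)))"
    by (intro sum.cong) (auto simp: f_inv_into_f)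
  also have "\<dots> = (\<Sum>i\<in>?J. h (g i))"
    by (rule sum.reindex_bij_betw[OF bij])
  finally have "(\<Sum>s\<in>g ` I. h s) = (\<Sum>i\<in>?J. h (g i))" .
  moreover have "?J \<subseteq> I"
    by (auto intro: inv_into_into)
  ultimately show ?thesis
    using that by blast
qed

lemma bezout_domain_lincomb_dvd:
  fixes g :: "'b \<Rightarrow> 'a::idom"
  assumes bz: "bezout_domain TYPE('a)" and I: "finite I"
  obtains c where "\<And>j. j \<in> I \<Longrightarrow> (\<Sum>i\<in>I. c i * g i) dvd g j"
proof -
  obtain d where ideal: "{(\<Sum>s\<in>g ` I. r s * s) | r. True} = {d * z | z. True}"
    using bz I unfolding bezout_domain_def by blast
  have "d \<in> {d * z | z. True}"
    by (auto intro: exI[of _ 1])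
  then obtain r where d: "d = (\<Sum>s\<in>g ` I. r s * s)"
    unfolding ideal[symmetric] by blast
  have dvd: "d dvd g j" if "j \<in> I" for j
  proof -
    have "(\<Sum>s\<in>g ` I. (if s = g j then 1 else 0) * s) = g j"
      using I that by (simp add: if_distrib[of "\<lambda>x. x * _"] sum.delta cong: if_cong)
    then have "g j \<in> {(\<Sum>s\<in>g ` I. r s * s) | r. True}"
      by (intro CollectI exI[of _ "\<lambda>s. if s = g j then 1 else 0"]) simp
    then have "g j \<in> {d * z | z. True}"
      unfolding ideal .
    then show ?thesis
      by auto
  qed
  obtain J where J: "J \<subseteq> I" and dJ: "d = (\<Sum>i\<in>J. r (g i) * g i)"
    using sum_image_representatives[OF I] d by blast
  have lincomb: "(\<Sum>i\<in>I. (if i \<in> J then r (g i) else 0) * g i) = d"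
    using I J by (simp add: dJ if_distrib[of "\<lambda>x. x * _"] sum.If_cases Int_absorb1)
  show ?thesis
    by (rule that[of "\<lambda>i. if i \<in> J then r (g i) else 0"]) (use lincomb dvd in simp)
qed

lemma bezout_row_pivot:
  fixes G :: "'a::idom mat"
  assumes bz: "bezout_domain TYPE('a)" and G: "G \<in> carrier_mat n m" and t: "t < n"
    and G_upper: "\<And>i j. i < t \<Longrightarrow> j < m \<Longrightarrow> G $$ (i, j) = 0"
  obtains V q where "V \<in> carrier_mat n 1" and "col_space V \<subseteq> col_space G"
    and "\<And>i. i < t \<Longrightarrow> V $$ (i, 0) = 0" and "\<And>j. j < m \<Longrightarrow> G $$ (t, j) = V $$ (t, 0) * q j"
proof -
  obtain c where c: "\<And>j. j \<in> {..<m} \<Longrightarrow> (\<Sum>i\<in>{..<m}. c i * G $$ (t, i)) dvd G $$ (t, j)"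
    using bezout_domain_lincomb_dvd[OF bz finite_lessThan, where g = "\<lambda>i. G $$ (t, i)"] by blast
  define V where "V = G * mat m 1 (\<lambda>(i, _). c i)"
  have V: "V \<in> carrier_mat n 1"
    using G by (simp add: V_def)
  have "col_space V \<subseteq> col_space G"
    unfolding V_def by (rule col_space_mult_subset[OF G mat_carrier])
  moreover have "V $$ (i, 0) = 0" if "i < t" for i
    using G t that G_upper by (simp add: V_def scalar_prod_def)
  moreover have "V $$ (t, 0) = (\<Sum>i<m. c i * G $$ (t, i))"
    using G t by (simp add: V_def scalar_prod_def lessThan_atLeast0 mult.commute)
  then have "\<forall>j. \<exists>r. j < m \<longrightarrow> G $$ (t, j) = V $$ (t, 0) * r"
    using c by (auto elim!: dvdE)
  then obtain q where "\<And>j. j < m \<Longrightarrow> G $$ (t, j) = V $$ (t, 0) * q j"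
    by metis
  ultimately show ?thesis
    using that V by blast
qed

lemma bezout_col_space_basis_zero_rows:
  fixes G :: "'a::idom mat"
  assumes bz: "bezout_domain TYPE('a)"
  shows "G \<in> carrier_mat n m \<Longrightarrow> (\<And>i j. i < t \<Longrightarrow> j < m \<Longrightarrow> G $$ (i, j) = 0) \<Longrightarrow>
    \<exists>k P. P \<in> carrier_mat n k \<and> col_space P = col_space G \<and> inj_on ((*\<^sub>v) P) (carrier_vec k)"
proof (induction "n - t" arbitrary: t G)
  case 0
  then have "G = 0\<^sub>m n m"
    by (intro eq_matI) auto
  moreover have "inj_on ((*\<^sub>v) (0\<^sub>m n 0 :: 'a mat)) (carrier_vec 0)"
    by (rule inj_onI) (auto intro: eq_vecI)
  ultimately show ?case
    by (metis col_space_zero_mat zero_carrier_mat)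
next
  case (Suc d)
  note G = Suc.prems(1) and G_upper = Suc.prems(2)
  have t: "t < n" and d: "d = n - Suc t"
    using Suc.hyps(2) by simp_all
  obtain V q where V: "V \<in> carrier_mat n 1" and V_sub: "col_space V \<subseteq> col_space G"
    and V_upper: "\<And>i. i < t \<Longrightarrow> V $$ (i, 0) = 0" and q: "\<And>j. j < m \<Longrightarrow> G $$ (t, j) = V $$ (t, 0) * q j"
    using bezout_row_pivot[OF bz G t G_upper] by blast
  show ?case
  proof (cases "V $$ (t, 0) = 0")
    case True
    then have "G $$ (i, j) = 0" if "i < Suc t" and "j < m" for i j
      using q G_upper that by (auto simp: less_Suc_eq)
    then show ?thesis
      by (rule Suc.hyps(1)[OF d G])
  next
    case False
    define Q where "Q = mat 1 m (\<lambda>(_, j). q j)"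
    have Q: "Q \<in> carrier_mat 1 m"
      by (simp add: Q_def)
    have G': "G - V * Q \<in> carrier_mat n m"
      by (rule minus_carrier_mat[OF mult_carrier_mat[OF V Q]])
    have G'_upper: "(G - V * Q) $$ (i, j) = 0" if "i < Suc t" and "j < m" for i j
      using that t G V q V_upper G_upper by (auto simp: Q_def scalar_prod_def less_Suc_eq)
    obtain k P where P: "P \<in> carrier_mat n k" and col_P: "col_space P = col_space (G - V * Q)"
      and inj_P: "inj_on ((*\<^sub>v) P) (carrier_vec k)"
      using Suc.hyps(1)[OF d G' G'_upper] by blast
    have P_t: "u $ t = 0" if u: "u \<in> col_space P" for u
    proof -
      obtain y where "y \<in> carrier_vec m" and "u = (G - V * Q) *\<^sub>v y"
        using u G' by (auto simp: col_P elim: mem_col_spaceE)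
      then show ?thesis
        using G'_upper by (simp add: mult_mat_vec_zero_row[OF G' t])
    qed
    have "col_space (append_cols V P) = col_space G"
      using col_space_append_cols[OF V P] col_space_add_diff_mult[OF G V Q V_sub] col_P by simp
    then show ?thesis
      using append_cols_carrier[OF V P] inj_on_append_col[OF V t False P inj_P P_t] by blast
  qed
qed

lemma bezout_col_space_basis:
  fixes G :: "'a::idom mat"
  assumes bz: "bezout_domain TYPE('a)" and G: "G \<in> carrier_mat n m"
  obtains k P where "P \<in> carrier_mat n k" and "col_space P = col_space G"
    and "inj_on ((*\<^sub>v) P) (carrier_vec k)"
  using bezout_col_space_basis_zero_rows[OF bz G, of 0] by auto

section \<open>Matrices of index at most one\<close>

lemma bezout_col_space_inter_kernel:
  fixes M :: "'a::idom mat"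
  assumes bz: "bezout_domain TYPE('a)" and M: "M \<in> carrier_mat n n"
    and idx: "col_space M \<subseteq> col_space (M * M)" and p: "p \<in> col_space M" and Mp: "M *\<^sub>v p = 0\<^sub>v n"
  shows "p = 0\<^sub>v n"
proof -
  obtain k P where P: "P \<in> carrier_mat n k" and col_P: "col_space P = col_space M"
    and inj_P: "inj_on ((*\<^sub>v) P) (carrier_vec k)"
    by (rule bezout_col_space_basis[OF bz M])
  have col_MP: "col_space (M * P) = col_space (M * M)"
    using col_space_mult[OF M P] col_space_mult[OF M M] col_P by simp
  \<comment> \<open>\<open>\<Phi>\<close> represents \<open>M\<close> on the free module \<open>col M\<close>, where it is onto; so \<open>det \<Phi> \<noteq> 0\<close>\<close>
  obtain \<Phi> where \<Phi>: "\<Phi> \<in> carrier_mat k k" and MP: "M * P = P * \<Phi>"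
    by (rule col_space_subset_imp_factor[OF P mult_carrier_mat[OF M P]])
      (use col_P col_MP col_space_mult_subset[OF M M] in auto)
  have "col_space P \<subseteq> col_space (P * \<Phi>)"
    using col_P col_MP MP idx by simp
  then obtain \<Psi> where \<Psi>: "\<Psi> \<in> carrier_mat k k" and P_\<Phi>\<Psi>: "P = P * \<Phi> * \<Psi>"
    by (rule col_space_subset_imp_factor[OF mult_carrier_mat[OF P \<Phi>] P])
  have "P * (\<Phi> * \<Psi>) = P * 1\<^sub>m k"
    using P_\<Phi>\<Psi> assoc_mult_mat[OF P \<Phi> \<Psi>] right_mult_one_mat[OF P] by metis
  then have "\<Phi> * \<Psi> = 1\<^sub>m k"
    by (rule inj_on_mult_mat_cancel_left[OF inj_P P, rotated 2]) (use \<Phi> \<Psi> in auto)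
  then have det_\<Phi>: "det \<Phi> \<noteq> 0"
    using det_mult[OF \<Phi> \<Psi>] by auto
  obtain x where x: "x \<in> carrier_vec k" and p_def: "p = P *\<^sub>v x"
    using p col_P P by (metis mem_col_spaceE)
  have "P *\<^sub>v (\<Phi> *\<^sub>v x) = (M * P) *\<^sub>v x"
    using P \<Phi> x MP by simp
  also have "\<dots> = M *\<^sub>v p"
    using M P x by (simp add: p_def)
  finally have "P *\<^sub>v (\<Phi> *\<^sub>v x) = M *\<^sub>v p" .
  then have "\<Phi> *\<^sub>v x = 0\<^sub>v k"
    using inj_on_mult_mat_vecD[OF inj_P P] \<Phi> x Mp by simp
  then have "x = 0\<^sub>v k"
    using det_\<Phi> det_0_iff_vec_prod_zero[OF \<Phi>] x by blast
  then show ?thesis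
    using P by (simp add: p_def mult_mat_vec_zero)
qed

lemma bezout_kernel_complement:
  fixes M P :: "'a::idom mat"
  assumes bz: "bezout_domain TYPE('a)" and M: "M \<in> carrier_mat n n"
    and idx: "col_space M \<subseteq> col_space (M * M)"
    and P: "P \<in> carrier_mat n s" and col_P: "col_space P = col_space M"
    and inj_P: "inj_on ((*\<^sub>v) P) (carrier_vec s)"
  obtains k K where "K \<in> carrier_mat n k" and "M * K = 0\<^sub>m n k"
    and "col_space (append_cols P K) = carrier_vec n"
    and "inj_on ((*\<^sub>v) (append_cols P K)) (carrier_vec (s + k))"
proof -
  obtain Y where Y: "Y \<in> carrier_mat n n" and MMY: "M = M * M * Y"
    by (rule col_space_subset_imp_factor[OF mult_carrier_mat[OF M M] M idx])
  define E where "E = 1\<^sub>m n - M * Y"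
  have E: "E \<in> carrier_mat n n"
    unfolding E_def using M Y by (metis minus_carrier_mat mult_carrier_mat)
  have Ev: "E *\<^sub>v v = v - M *\<^sub>v (Y *\<^sub>v v)" if "v \<in> carrier_vec n" for v
    unfolding E_def using M Y that by (simp add: minus_mult_distrib_mat_vec[of _ n n "M * Y"])
  have ME: "M *\<^sub>v (E *\<^sub>v v) = 0\<^sub>v n" if "v \<in> carrier_vec n" for v
  proof -
    have "M *\<^sub>v v = (M * M * Y) *\<^sub>v v"
      by (simp only: MMY[symmetric])
    also have "\<dots> = M *\<^sub>v (M *\<^sub>v (Y *\<^sub>v v))"
      by (simp only: assoc_mult_mat_vec[OF mult_carrier_mat[OF M M] Y that]
          assoc_mult_mat_vec[OF M M mult_mat_vec_carrier[OF Y that]])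
    finally show ?thesis
      using M Y that by (simp add: Ev mult_minus_distrib_mat_vec)
  qed
  obtain k K where K: "K \<in> carrier_mat n k" and col_K: "col_space K = col_space E"
    and inj_K: "inj_on ((*\<^sub>v) K) (carrier_vec k)"
    by (rule bezout_col_space_basis[OF bz E])
  have kernel: "M *\<^sub>v w = 0\<^sub>v n" if "w \<in> col_space K" for w
    using that E ME by (auto simp: col_K elim: mem_col_spaceE)
  have "M * K = 0\<^sub>m n k"
  proof (rule mat_eq_on_vecI[of _ n k])
    fix x :: "'a vec" assume x: "x \<in> carrier_vec k"
    have "0\<^sub>m n k *\<^sub>v x = 0\<^sub>v n"
      using x by (intro eq_vecI) (auto simp: scalar_prod_def)
    then show "(M * K) *\<^sub>v x = 0\<^sub>m n k *\<^sub>v x"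
      using M K x kernel[OF mult_mat_vec_mem_col_space[OF K x]] by simp
  qed (use M K in auto)
  moreover have "col_space (append_cols P K) = carrier_vec n"
  proof (intro equalityI subsetI)
    fix v :: "'a vec" assume v: "v \<in> carrier_vec n"
    have "v = M *\<^sub>v (Y *\<^sub>v v) + E *\<^sub>v v"
      using M Y v by (auto simp: Ev intro!: eq_vecI)
    moreover have "M *\<^sub>v (Y *\<^sub>v v) \<in> col_space P" and "E *\<^sub>v v \<in> col_space K"
      using M Y E v by (auto simp: col_P col_K)
    ultimately show "v \<in> col_space (append_cols P K)"
      using col_space_append_cols[OF P K] by blast
  qed (use col_space_carrier[OF append_cols_carrier[OF P K]] in auto)
  moreover have "col_space P \<inter> col_space K = {0\<^sub>v n}"
    using bezout_col_space_inter_kernel[OF bz M idx] kernel zero_mem_col_space[OF P]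
      zero_mem_col_space[OF K] by (auto simp: col_P)
  then have "inj_on ((*\<^sub>v) (append_cols P K)) (carrier_vec (s + k))"
    by (rule inj_on_append_cols[OF P K inj_P inj_K])
  ultimately show ?thesis
    using that K by blast
qed

section \<open>Similarity\<close>

lemma similar_mat_if_intertwined:
  fixes M N W W' :: "'a::comm_ring_1 mat"
  assumes M: "M \<in> carrier_mat n n" and N: "N \<in> carrier_mat n n"
    and W: "W \<in> carrier_mat n n" and W': "W' \<in> carrier_mat n n"
    and WW': "W * W' = 1\<^sub>m n" and W'W: "W' * W = 1\<^sub>m n" and MW: "M * W = W * N"
  shows "similar_mat M N"
proof -
  have "M = M * (W * W')"
    using M by (simp add: WW')
  also have "\<dots> = W * N * W'"
    using M W W' N by (metis MW assoc_mult_mat)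
  finally have "similar_mat_wit M N W W'"
    using similar_mat_witI[OF WW' W'W _ M N W W'] by blast
  then show ?thesis
    unfolding similar_mat_def by blast
qed

lemma mult_inverse_mult_eq_one:
  fixes X X' Y Y' :: "'a::semiring_1 mat"
  assumes X: "X \<in> carrier_mat n n" and X': "X' \<in> carrier_mat n n"
    and Y: "Y \<in> carrier_mat n n" and Y': "Y' \<in> carrier_mat n n"
    and XX': "X * X' = 1\<^sub>m n" and Y'Y: "Y' * Y = 1\<^sub>m n"
  shows "X * Y' * (Y * X') = 1\<^sub>m n"
proof -
  have "X * Y' * (Y * X') = X * ((Y' * Y) * X')"
    using assoc_mult_mat[OF X Y' mult_carrier_mat[OF Y X']] assoc_mult_mat[OF Y' Y X'] by simp
  then show ?thesis
    using X' by (simp add: Y'Y XX')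
qed

lemma similar_mat_of_adapted_bases:
  fixes M N A P K L :: "'a::idom mat"
  assumes M: "M \<in> carrier_mat n n" and N: "N \<in> carrier_mat n n" and A: "A \<in> carrier_mat n n"
    and MA: "M * A = A * N"
    and P: "P \<in> carrier_mat n s" and K: "K \<in> carrier_mat n k" and L: "L \<in> carrier_mat n l"
    and col_N: "col_space N \<subseteq> col_space P"
    and N_kills_K: "N * K = 0\<^sub>m n k" and M_kills_L: "M * L = 0\<^sub>m n l"
    and S_surj: "col_space (append_cols P K) = carrier_vec n"
    and S_inj: "inj_on ((*\<^sub>v) (append_cols P K)) (carrier_vec (s + k))"
    and R_surj: "col_space (append_cols (A * P) L) = carrier_vec n"
    and R_inj: "inj_on ((*\<^sub>v) (append_cols (A * P) L)) (carrier_vec (s + l))"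
  shows "similar_mat M N"
proof -
  let ?S = "append_cols P K" and ?R = "append_cols (A * P) L"
  have AP: "A * P \<in> carrier_mat n s"
    using A P by simp
  obtain S' where sk: "s + k = n" and S': "S' \<in> carrier_mat n n"
    and SS': "?S * S' = 1\<^sub>m n" and S'S: "S' * ?S = 1\<^sub>m n"
    by (rule bij_mat_inverse[OF append_cols_carrier[OF P K] S_surj S_inj])
  obtain R' where sl: "s + l = n" and R': "R' \<in> carrier_mat n n"
    and RR': "?R * R' = 1\<^sub>m n" and R'R: "R' * ?R = 1\<^sub>m n"
    by (rule bij_mat_inverse[OF append_cols_carrier[OF AP L] R_surj R_inj])
  have lk: "l = k"
    using sk sl by simp
  have S: "?S \<in> carrier_mat n n" and R: "?R \<in> carrier_mat n n"
    using append_cols_carrier[OF P K] append_cols_carrier[OF AP L] sk sl by simp_all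
  \<comment> \<open>With \<open>W = R S'\<close>, both \<open>M W\<close> and \<open>W N\<close> equal \<open>A N\<close>.\<close>
  obtain X where X: "X \<in> carrier_mat s n" and NPX: "N = P * X"
    by (rule col_space_subset_imp_factor[OF P N col_N])
  have "M * ?R = append_cols (A * N * P) (0\<^sub>m n k)"
    using mult_append_cols[OF M AP L] MA M_kills_L M A N P lk by (simp flip: assoc_mult_mat)
  also have "\<dots> = append_cols (A * N * P) (A * N * K)"
    using A N K N_kills_K by simp
  also have "\<dots> = A * N * ?S"
    using A N P K
    by (simp only: mult_append_cols[of "A * N" n n P s K k, symmetric] mult_carrier_mat)
  finally have MR: "M * ?R = A * N * ?S" .
  have "M * (?R * S') = (M * ?R) * S'"
    using M R S' by simp
  also have "\<dots> = A * N * (?S * S')"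
    using A N by (simp only: MR assoc_mult_mat[OF mult_carrier_mat[OF A N] S S'])
  finally have MW: "M * (?R * S') = A * N"
    using A N by (simp add: SS')
  have RS'P: "?R * S' * P = A * P"
    by (rule append_cols_left_inverse_mult[OF P K AP L[unfolded lk]]) (use S' S'S sk lk in auto)
  have "?R * S' * N = ?R * S' * P * X"
    unfolding NPX by (rule assoc_mult_mat[OF mult_carrier_mat[OF R S'] P X, symmetric])
  also have "\<dots> = A * N"
    unfolding RS'P NPX by (rule assoc_mult_mat[OF A P X])
  finally have WN: "?R * S' * N = A * N" .
  show ?thesis
    using MW WN by (intro similar_mat_if_intertwined[OF M N mult_carrier_mat[OF R S']
          mult_carrier_mat[OF S R'] mult_inverse_mult_eq_one[OF R R' S S' RR' S'S]
          mult_inverse_mult_eq_one[OF S S' R R' SS' R'R]]) simp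
qed

lemma bezout_intertwiner_inj_on_col_space:
  fixes M A C :: "'a::idom mat"
  assumes bz: "bezout_domain TYPE('a)"
    and M: "M \<in> carrier_mat n n" and A: "A \<in> carrier_mat n n" and C: "C \<in> carrier_mat n n"
    and idx_M: "col_space M \<subseteq> col_space (M * M)" and col_A: "col_space A \<subseteq> col_space M"
    and MA: "M * A = A * (C * A)"
    and u: "u \<in> col_space (C * A)" and Au: "A *\<^sub>v u = 0\<^sub>v n"
  shows "u = 0\<^sub>v n"
proof -
  obtain w where w: "w \<in> carrier_vec n" and u_def: "u = C *\<^sub>v (A *\<^sub>v w)"
    using u C A by (auto elim: mem_col_spaceE)
  have "M *\<^sub>v (A *\<^sub>v w) = (A * (C * A)) *\<^sub>v w"
    using M A w by (simp flip: MA)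
  also have "\<dots> = A *\<^sub>v u"
    using A C w by (simp add: u_def assoc_mult_mat_vec[OF A mult_carrier_mat[OF C A] w])
  finally have "M *\<^sub>v (A *\<^sub>v w) = 0\<^sub>v n"
    using Au by simp
  moreover have "A *\<^sub>v w \<in> col_space M"
    using A w col_A by auto
  ultimately have "A *\<^sub>v w = 0\<^sub>v n"
    using bezout_col_space_inter_kernel[OF bz M idx_M] by simp
  then show ?thesis
    using C by (simp add: u_def mult_mat_vec_zero)
qed

lemma bezout_similar_mat_if_iso_on_col_spaces:
  fixes M N A :: "'a::idom mat"
  assumes bz: "bezout_domain TYPE('a)"
    and M: "M \<in> carrier_mat n n" and N: "N \<in> carrier_mat n n" and A: "A \<in> carrier_mat n n"
    and idx_M: "col_space M \<subseteq> col_space (M * M)" and idx_N: "col_space N \<subseteq> col_space (N * N)"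
    and MA: "M * A = A * N" and col_AN: "col_space (A * N) = col_space M"
    and A_inj: "\<And>u. u \<in> col_space N \<Longrightarrow> A *\<^sub>v u = 0\<^sub>v n \<Longrightarrow> u = 0\<^sub>v n"
  shows "similar_mat M N"
proof -
  obtain s P where P: "P \<in> carrier_mat n s" and col_P: "col_space P = col_space N"
    and inj_P: "inj_on ((*\<^sub>v) P) (carrier_vec s)"
    by (rule bezout_col_space_basis[OF bz N])
  have AP: "A * P \<in> carrier_mat n s"
    using A P by simp
  have col_AP: "col_space (A * P) = col_space M"
    using col_space_mult[OF A P] col_space_mult[OF A N] col_P col_AN by simp
  have inj_AP: "inj_on ((*\<^sub>v) (A * P)) (carrier_vec s)"
  proof (rule inj_on_mult_mat_vecI[OF AP])
    fix x :: "'a vec" assume x: "x \<in> carrier_vec s" and "(A * P) *\<^sub>v x = 0\<^sub>v n"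
    then have "P *\<^sub>v x = 0\<^sub>v n"
      using A_inj A P col_P by auto
    then show "x = 0\<^sub>v s"
      by (rule inj_on_mult_mat_vecD[OF inj_P P x])
  qed
  obtain k K where K: "K \<in> carrier_mat n k" and N_kills_K: "N * K = 0\<^sub>m n k"
    and S: "col_space (append_cols P K) = carrier_vec n"
      "inj_on ((*\<^sub>v) (append_cols P K)) (carrier_vec (s + k))"
    by (rule bezout_kernel_complement[OF bz N idx_N P col_P inj_P])
  obtain l L where L: "L \<in> carrier_mat n l" and M_kills_L: "M * L = 0\<^sub>m n l"
    and R: "col_space (append_cols (A * P) L) = carrier_vec n"
      "inj_on ((*\<^sub>v) (append_cols (A * P) L)) (carrier_vec (s + l))"
    by (rule bezout_kernel_complement[OF bz M idx_M AP col_AP inj_AP])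
  show ?thesis
    by (rule similar_mat_of_adapted_bases[OF M N A MA P K L _ N_kills_K M_kills_L S R])
      (use col_P in simp)
qed

theorem corollary2p2:
  fixes A B C :: "'a::idom mat" and n :: nat
  assumes "bezout_domain TYPE('a)"
    and "A \<in> carrier_mat n n" and "B \<in> carrier_mat n n" and "C \<in> carrier_mat n n"
    and "A * B * A = A * C * A"
    and "col_space A = col_space (A * B * A)"
  shows "similar_mat (A * B) (C * A)"
proof -
  note bz = assms(1) and A = assms(2) and B = assms(3) and C = assms(4)
  define M N where "M = A * B" and "N = C * A"
  have M: "M \<in> carrier_mat n n" and N: "N \<in> carrier_mat n n"
    using A B C by (simp_all add: M_def N_def)
  have MA: "M * A = A * N" and ABA: "A * B * A = A * N"
    using assms(5) A B C by (simp_all add: M_def N_def)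
  obtain X where X: "X \<in> carrier_mat n n" and ANX: "A = A * N * X"
    by (rule col_space_subset_imp_factor[OF mult_carrier_mat[OF A N] A]) (use assms(6) ABA in simp)
  have col_M: "col_space M = col_space A"
    using col_space_mult_subset[OF A B] col_space_mult_subset[OF M A] assms(6)
    by (auto simp: M_def)
  have col_AN: "col_space (A * N) = col_space M"
    using col_space_mult_eq_of_factor[OF A N X ANX[symmetric]] col_M by simp
  have "col_space (M * M) = col_space M"
    using col_space_mult[OF M M] col_space_mult[OF M A] col_M col_AN MA by simp
  then have idx_M: "col_space M \<subseteq> col_space (M * M)"
    by simp
  have "N * N * X = C * (A * N * X)"
    using assoc_mult_mat[OF C A N] assoc_mult_mat[OF C mult_carrier_mat[OF A N] X] by (metis N_def)
  then have "col_space N \<subseteq> col_space (N * N)"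
    using col_space_mult_subset[OF mult_carrier_mat[OF N N] X] by (simp flip: ANX N_def)
  moreover have "u = 0\<^sub>v n" if "u \<in> col_space N" and "A *\<^sub>v u = 0\<^sub>v n" for u
    using bezout_intertwiner_inj_on_col_space[OF bz M A C idx_M _ MA[unfolded N_def]] col_M that
    by (simp add: N_def)
  ultimately have "similar_mat M N"
    using bezout_similar_mat_if_iso_on_col_spaces[OF bz M N A idx_M _ MA col_AN] by blast
  then show ?thesis
    by (simp add: M_def N_def)
qed

end
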